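(* Suppose $\alpha>0$, $P\in\mathbb R^{N\times N}$ is symmetric positive definite, and $Q=\mathrm{diag}(q_1,\dots,q_M)\in\mathbb R^{M\times M}$ is diagonal with $q_i>0$. If the spectral norm satisfies $\|Q^{-1/2}LP^{-1/2}\|\le1$, then for any $x_0\in\mathbb R^N$ and $y_0\in\mathbb R^M$ the sequence $\{x_k\}_{k\in\mathbb N}$ generated by the explicit iteration $$(y_{k+1})_i=\mathrm{Proj}_{[-\alpha,\alpha]}\Big((y_k)_i+\frac{(Lx_k)_i-d_i}{q_i}\Big),\quad i=1,\dots,M,$$ $$x_{k+1}=(P+2\alpha B)^{-1}\big(L^*(y_k-2y_{k+1})+Px_k-\alpha b\big),$$ converges to a solution of the optimization problem $$\operatorname*{arg\,min}_{x\in\mathbb R^N}\ \{x^*Bx+b^*x+\|Lx-d\|_1\}.$$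
   Context: $^*$ denotes transpose, $\|\cdot\|_1$ is the $\ell^1$ norm on $\mathbb R^M$, and $\mathrm{Proj}_{[-\alpha,\alpha]}$ is the projection of $\mathbb R$ onto $[-\alpha,\alpha]$. The data $B,b,L,d$ come from a discretized least-squares problem. Let $W_h$, $\boldsymbol V_h$ be finite-dimensional spaces of (respectively scalar and vector-valued) piecewise polynomial functions, of degrees at most $k$ and $k-1$, on a triangulation $\mathcal T_h$ of mesh size $h$ of a bounded polytope $\Omega$; let $A\in L^\infty(\Omega)$ be matrix-valued and $f\in L^2(\Omega)$. Identify $(w,\boldsymbol v)\in W_h\times\boldsymbol V_h$ with its coefficient vector $x\in\mathbb R^N$ in a fixed basis of $W_h\times\boldsymbol V_h$. The symmetric positive semi-definite matrix $B\in\mathbb R^{N\times N}$ and the vector $b\in\mathbb R^N$ are determined by $$x^*Bx+b^*x=\|A:\nabla\boldsymbol v-f\|^2_{L^2}+h^{-2}\|\boldsymbol v-\nabla w\|^2_{L^2}-\|f\|_{L^2}^2\quad\text{for all }x,$$ with elementwise gradients and $A:\nabla\boldsymbol v=\sum_{i,j}A_{ij}\partial_jv_i$. The matrix $L\in\mathbb R^{M\times N}$ stacks the blocks $\tau h^{-1}L_1$, $\tau h^{-1}L_2$, $\tau h^{-2}L_3$ with $\tau>0$, where $L_1x$ lists the endpoint values of the normal jumps of $\boldsymbol v$ on interior faces, $L_2x$ lists the endpoint and midpoint values of the jumps of $w$ on interior faces, and $L_3x$ lists the endpoint and midpoint values of $w$ on boundary faces; $d\in\mathbb R^M$ is the vector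 whose first two blocks vanish and whose last block lists the corresponding boundary data values. *)

theory Defs
  imports "HOL-Analysis.Analysis"
begin

section \<open>Matrices and norms\<close>

definition symmetric_matrix :: "real^'n^'n \<Rightarrow> bool" where
  "symmetric_matrix A \<longleftrightarrow> transpose A = A"

definition pos_semidef :: "real^'n^'n \<Rightarrow> bool" where
  "pos_semidef A \<longleftrightarrow> (\<forall>x. 0 \<le> x \<bullet> (A *v x))"

definition pos_def :: "real^'n^'n \<Rightarrow> bool" where
  "pos_def A \<longleftrightarrow> (\<forall>x. x \<noteq> 0 \<longrightarrow> 0 < x \<bullet> (A *v x))"

definition diag_matrix :: "real^'n \<Rightarrow> real^'n^'n" where
  "diag_matrix q = (\<chi> i j. if i = j then q $ i else 0)"

text \<open>The principal square root; it is unique for symmetric positive definite \<open>A\<close>.\<close>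

definition matrix_sqrt :: "real^'n^'n \<Rightarrow> real^'n^'n" where
  "matrix_sqrt A = (THE S. symmetric_matrix S \<and> pos_def S \<and> S ** S = A)"

definition matrix_inv_sqrt :: "real^'n^'n \<Rightarrow> real^'n^'n" where
  "matrix_inv_sqrt A = matrix_inv (matrix_sqrt A)"

definition spectral_norm :: "real^'n^'m \<Rightarrow> real" where
  "spectral_norm A = onorm ((*v) A)"

definition l1_norm :: "real^'m \<Rightarrow> real" where
  "l1_norm y = (\<Sum>i\<in>UNIV. \<bar>y $ i\<bar>)"

definition frobenius_product :: "real^'d^'d \<Rightarrow> real^'d^'d \<Rightarrow> real" where
  "frobenius_product A C = (\<Sum>i\<in>UNIV. \<Sum>j\<in>UNIV. A $ i $ j * C $ i $ j)"

section \<open>Lebesgue spaces\<close>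

definition L2_norm :: "(real^'d) set \<Rightarrow> (real^'d \<Rightarrow> 'b::real_normed_vector) \<Rightarrow> real" where
  "L2_norm \<Omega> u = sqrt (LINT p|lebesgue_on \<Omega>. (norm (u p))\<^sup>2)"

definition in_L2 :: "(real^'d) set \<Rightarrow> (real^'d \<Rightarrow> real) \<Rightarrow> bool" where
  "in_L2 \<Omega> u \<longleftrightarrow>
     u \<in> borel_measurable (lebesgue_on \<Omega>) \<and> integrable (lebesgue_on \<Omega>) (\<lambda>p. (u p)\<^sup>2)"

definition in_Linfty :: "(real^'d) set \<Rightarrow> (real^'d \<Rightarrow> real^'d^'d) \<Rightarrow> bool" where
  "in_Linfty \<Omega> u \<longleftrightarrow>
     u \<in> borel_measurable (lebesgue_on \<Omega>) \<and> (\<exists>c. AE p in lebesgue_on \<Omega>. norm (u p) \<le> c)"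

section \<open>Triangulations\<close>

text \<open>
  The domain is any set between the interior and the whole of the union of the simplices, so that
  open and closed domains, convex or not, are all admitted; such an \<open>\<Omega>\<close> is bounded and differs from
  its closure by a null set. Conformity of the mesh is part of \<open>triangulation\<close>.
\<close>

definition triangulates :: "(real^'d) set set \<Rightarrow> (real^'d) set \<Rightarrow> bool" where
  "triangulates \<T> \<Omega> \<longleftrightarrow>
     triangulation \<T> \<and> \<T> \<noteq> {} \<and> (\<forall>T\<in>\<T>. int CARD('d) simplex T) \<and>
     interior (\<Union>\<T>) \<subseteq> \<Omega> \<and> \<Omega> \<subseteq> \<Union>\<T>"

definition mesh_size :: "(real^'d) set set \<Rightarrow> real" where
  "mesh_size \<T> = Max (diameter ` \<T>)"

definition elements_at :: "(real^'d) set set \<Rightarrow> (real^'d) set \<Rightarrow> (real^'d) set set" where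
  "elements_at \<T> F = {T \<in> \<T>. F facet_of T}"

definition interior_faces :: "(real^'d) set set \<Rightarrow> (real^'d) set set" where
  "interior_faces \<T> = {F. card (elements_at \<T> F) = 2}"

definition boundary_faces :: "(real^'d) set set \<Rightarrow> (real^'d) set set" where
  "boundary_faces \<T> = {F. card (elements_at \<T> F) = 1}"

text \<open>
  In the plane a face is a segment with two endpoints and one midpoint. In other dimensions the
  vertices of the face and the midpoints of its edges are taken.
\<close>

definition endpoints :: "(real^'d) set \<Rightarrow> (real^'d) set" where
  "endpoints F = {p. p extreme_point_of F}"

definition midpoints :: "(real^'d) set \<Rightarrow> (real^'d) set" where
  "midpoints F = {midpoint p q |p q. p \<in> endpoints F \<and> q \<in> endpoints F \<and> p \<noteq> q}"

definition outward_normal :: "(real^'d) set \<Rightarrow> (real^'d) set \<Rightarrow> real^'d" where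
  "outward_normal T F = (THE \<nu>. norm \<nu> = 1 \<and> (\<forall>p\<in>F. \<forall>q\<in>T. \<nu> \<bullet> (q - p) \<le> 0))"

text \<open>
  An orientation names the two elements at an interior face; it fixes the sign of the jump of a
  scalar function.
\<close>

definition orientation ::
    "(real^'d) set set \<Rightarrow> ((real^'d) set \<Rightarrow> (real^'d) set) \<Rightarrow> ((real^'d) set \<Rightarrow> (real^'d) set) \<Rightarrow> bool"
  where
  "orientation \<T> Tp Tm \<longleftrightarrow> (\<forall>F\<in>interior_faces \<T>. {Tp F, Tm F} = elements_at \<T> F)"

section \<open>Piecewise polynomial functions\<close>

text \<open>
  Polynomials in several variables of total degree at most \<open>k\<close>; \<open>a\<close> ranges over multi-indices.
\<close>

lemma finite_multi_indices: "finite {a :: 'd::finite \<Rightarrow> nat. sum a UNIV \<le> k}"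
proof (rule finite_subset)
  have "a i \<le> sum a UNIV" for a :: "'d \<Rightarrow> nat" and i
    by (rule member_le_sum) simp_all
  then show "{a :: 'd \<Rightarrow> nat. sum a UNIV \<le> k} \<subseteq> PiE UNIV (\<lambda>_. {..k})"
    by (simp add: subset_iff PiE_UNIV_domain Pi_iff) (meson order_trans)
  show "finite (PiE (UNIV :: 'd set) (\<lambda>_. {..k}))"
    by (rule finite_PiE) simp_all
qed

definition polynomial_of_degree_le :: "nat \<Rightarrow> (real^'d \<Rightarrow> real) \<Rightarrow> bool" where
  "polynomial_of_degree_le k u \<longleftrightarrow>
     (\<exists>c. u = (\<lambda>p. \<Sum>a | sum a UNIV \<le> k. c a * (\<Prod>i\<in>UNIV. (p $ i) ^ a i)))"

text \<open>
  A piecewise polynomial function is discontinuous across faces, hence it is represented by the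
  family \<open>u\<close> of its restrictions: \<open>u T\<close> is the polynomial, on the whole space, that it coincides
  with on the interior of the element \<open>T\<close>. Traces on faces are values of \<open>u T\<close>. Normalising
  \<open>u T = 0\<close> for \<open>T \<notin> \<T>\<close> makes the representation unique.
\<close>

type_synonym ('d, 'b) broken = "(real^'d) set \<Rightarrow> real^'d \<Rightarrow> 'b"

definition piecewise_polynomial :: "(real^'d) set set \<Rightarrow> nat \<Rightarrow> ('d, real) broken \<Rightarrow> bool" where
  "piecewise_polynomial \<T> k u \<longleftrightarrow>
     (\<forall>T\<in>\<T>. polynomial_of_degree_le k (u T)) \<and> (\<forall>T. T \<notin> \<T> \<longrightarrow> u T = (\<lambda>p. 0))"

definition piecewise_polynomial_vec ::
    "(real^'d) set set \<Rightarrow> nat \<Rightarrow> ('d, real^'d) broken \<Rightarrow> bool" where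
  "piecewise_polynomial_vec \<T> k u \<longleftrightarrow> (\<forall>i. piecewise_polynomial \<T> k (\<lambda>T p. u T p $ i))"

text \<open>The function on the domain given by a family; it is determined off the faces, a null set.\<close>

definition glue :: "(real^'d) set set \<Rightarrow> ('d, 'b) broken \<Rightarrow> real^'d \<Rightarrow> 'b" where
  "glue \<T> u p = u (THE T. T \<in> \<T> \<and> p \<in> interior T) p"

text \<open>Elementwise gradients; the entry of \<open>broken_jacobian v\<close> in row \<open>i\<close>, column \<open>j\<close> is
  \<open>\<partial>\<^sub>j v\<^sub>i\<close>.\<close>

definition broken_grad :: "('d, real) broken \<Rightarrow> ('d, real^'d) broken" where
  "broken_grad w T p = (\<chi> j. frechet_derivative (w T) (at p) (axis j 1))"

definition broken_jacobian :: "('d, real^'d) broken \<Rightarrow> ('d, real^'d^'d) broken" where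
  "broken_jacobian v T p = jacobian (v T) (at p)"

text \<open>Function types carry no vector space structure in the library, so linear subspaces and linear
  combinations of broken functions are spelled out.\<close>

definition broken_subspace :: "('d, 'b::real_vector) broken set \<Rightarrow> bool" where
  "broken_subspace S \<longleftrightarrow>
     (\<lambda>T p. 0) \<in> S \<and>
     (\<forall>u\<in>S. \<forall>v\<in>S. (\<lambda>T p. u T p + v T p) \<in> S) \<and>
     (\<forall>c. \<forall>u\<in>S. (\<lambda>T p. c *\<^sub>R u T p) \<in> S)"

definition lincomb :: "('n::finite \<Rightarrow> ('d, 'b::real_vector) broken) \<Rightarrow> real^'n \<Rightarrow> ('d, 'b) broken" where
  "lincomb \<phi> x T p = (\<Sum>j\<in>UNIV. (x $ j) *\<^sub>R \<phi> j T p)"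

text \<open>The pairs \<open>(\<phi>w j, \<phi>v j)\<close> form a basis of \<open>W \<times> V\<close>: every element of \<open>W \<times> V\<close> is a linear
  combination of them with unique coefficients.\<close>

definition product_basis ::
    "('n::finite \<Rightarrow> ('d, real) broken) \<Rightarrow> ('n \<Rightarrow> ('d, real^'d) broken) \<Rightarrow>
     ('d, real) broken set \<Rightarrow> ('d, real^'d) broken set \<Rightarrow> bool" where
  "product_basis \<phi>w \<phi>v W V \<longleftrightarrow>
     bij_betw (\<lambda>x :: real^'n. (lincomb \<phi>w x, lincomb \<phi>v x)) UNIV (W \<times> V)"

section \<open>The least-squares functional and the penalty\<close>

definition least_squares ::
    "(real^'d) set \<Rightarrow> (real^'d) set set \<Rightarrow> (real^'d \<Rightarrow> real^'d^'d) \<Rightarrow> (real^'d \<Rightarrow> real) \<Rightarrow>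
     ('d, real) broken \<Rightarrow> ('d, real^'d) broken \<Rightarrow> real" where
  "least_squares \<Omega> \<T> A f w v =
     (L2_norm \<Omega> (\<lambda>p. frobenius_product (A p) (glue \<T> (broken_jacobian v) p) - f p))\<^sup>2
     + (1 / (mesh_size \<T>)\<^sup>2) * (L2_norm \<Omega> (\<lambda>p. glue \<T> v p - glue \<T> (broken_grad w) p))\<^sup>2"

text \<open>The rows of \<open>L\<close>: one for each pair of a face and a node on that face, in three blocks.\<close>

datatype 'p penalty_row =
    Normal_Jump "'p set" 'p
  | Jump "'p set" 'p
  | Boundary_Value "'p set" 'p

definition penalty_rows :: "(real^'d) set set \<Rightarrow> (real^'d) penalty_row set" where
  "penalty_rows \<T> =
     {Normal_Jump F p |F p. F \<in> interior_faces \<T> \<and> p \<in> endpoints F} \<union>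
     {Jump F p |F p. F \<in> interior_faces \<T> \<and> p \<in> endpoints F \<union> midpoints F} \<union>
     {Boundary_Value F p |F p. F \<in> boundary_faces \<T> \<and> p \<in> endpoints F \<union> midpoints F}"

definition boundary_element :: "(real^'d) set set \<Rightarrow> (real^'d) set \<Rightarrow> (real^'d) set" where
  "boundary_element \<T> F = (THE T. T \<in> elements_at \<T> F)"

fun penalty_value ::
    "(real^'d) set set \<Rightarrow> ((real^'d) set \<Rightarrow> (real^'d) set) \<Rightarrow> ((real^'d) set \<Rightarrow> (real^'d) set) \<Rightarrow> real \<Rightarrow>
     ('d, real) broken \<Rightarrow> ('d, real^'d) broken \<Rightarrow> (real^'d) penalty_row \<Rightarrow> real" where
  "penalty_value \<T> Tp Tm \<tau> w v (Normal_Jump F p) =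
     \<tau> / mesh_size \<T> *
       (v (Tp F) p \<bullet> outward_normal (Tp F) F + v (Tm F) p \<bullet> outward_normal (Tm F) F)"
| "penalty_value \<T> Tp Tm \<tau> w v (Jump F p) = \<tau> / mesh_size \<T> * (w (Tp F) p - w (Tm F) p)"
| "penalty_value \<T> Tp Tm \<tau> w v (Boundary_Value F p) =
     \<tau> / (mesh_size \<T>)\<^sup>2 * w (boundary_element \<T> F) p"

text \<open>The target carries the same factor as the rows of the last block, so that these penalise the
  difference of \<open>w\<close> and the boundary data \<open>g\<close>. As \<open>g\<close> is arbitrary, the factor could be absorbed
  in it.\<close>

fun penalty_target ::
    "(real^'d) set set \<Rightarrow> real \<Rightarrow> (real^'d \<Rightarrow> real) \<Rightarrow> (real^'d) penalty_row \<Rightarrow> real" where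
  "penalty_target \<T> \<tau> g (Normal_Jump F p) = 0"
| "penalty_target \<T> \<tau> g (Jump F p) = 0"
| "penalty_target \<T> \<tau> g (Boundary_Value F p) = \<tau> / (mesh_size \<T>)\<^sup>2 * g p"

end

theory Submission
  imports Defs
begin

text \<open>
  The objective scaled by \<open>\<alpha>\<close> is \<open>h x + \<alpha> |L x - d|\<^sub>1\<close> with \<open>h x = \<alpha> (x \<bullet> B x + b \<bullet> x)\<close>, and
  \<open>\<alpha> |w|\<^sub>1\<close> is the maximum of \<open>y \<bullet> w\<close> over the box \<open>[-\<alpha>,\<alpha>]\<^sup>m\<close>. The minimisation thus becomes the
  search for a saddle point of \<open>h x + y \<bullet> (L x - d)\<close>, and the two updates of the iteration say that
  \<open>u\<^sub>n = (x\<^sub>n, y\<^sub>n)\<close> satisfies \<open>M (u\<^sub>n - u\<^sub>n\<^sub>+\<^sub>1) \<in> \<A> u\<^sub>n\<^sub>+\<^sub>1\<close>, where \<open>\<A>\<close> is the monotone operator of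
  the saddle-point problem and \<open>M\<close> is the symmetric block matrix with diagonal blocks \<open>P\<close>, \<open>Q\<close> and
  off-diagonal blocks \<open>L\<^sup>T\<close>, \<open>L\<close>.

  The norm condition makes \<open>M\<close> positive semidefinite (\<open>bilinear_bound_of_spectral_norm\<close>), but in
  the borderline case of norm \<open>1\<close> it is singular, and the usual Fejer argument controls only
  \<open>M u\<^sub>n\<close>. The next iterate, however, depends on the current one continuously and only through its
  image under \<open>M\<close>, so that convergence of the images carries over to the iterates
  (\<open>degenerate_proximal_point_converges\<close>). The argument starts from one saddle point. Its first
  component is a minimiser of the objective, which exists because the least-squares functional is
  nonnegative and therefore bounds the quadratic part below by \<open>-|f|\<^sup>2\<close>
  (\<open>penalised_quadratic_attains_min\<close>); its second is a Lagrange multiplier found by separation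
  (\<open>minimiser_has_multiplier\<close>). Conversely the limit is a saddle point and hence optimal
  (\<open>saddle_point_minimises\<close>).

  The norm condition is phrased with the square roots of \<open>P\<close> and \<open>Q\<close>, so their existence and
  uniqueness are established as well (\<open>matrix_sqrt\<close>).
\<close>

section \<open>Positive semidefinite operators\<close>

lemma symmetric_inner:
  assumes "symmetric_matrix A"
  shows "(A *v u) \<bullet> v = u \<bullet> (A *v v)"
  using assms unfolding symmetric_matrix_def
  by (metis dot_lmul_matrix transpose_matrix_vector)

lemma inner_symmetric_matrix:
  assumes "\<And>u v. (A *v u) \<bullet> v = u \<bullet> (A *v v)"
  shows "symmetric_matrix A"
  unfolding symmetric_matrix_def
  by (metis assms matrix_eq transpose_matrix_vector dot_lmul_matrix inner_commute vector_eq_rdot)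

definition psd_operator :: "('a::real_inner \<Rightarrow> 'a) \<Rightarrow> bool" where
  "psd_operator T \<longleftrightarrow>
     linear T \<and> (\<forall>u v. T u \<bullet> v = u \<bullet> T v) \<and> (\<forall>u. 0 \<le> u \<bullet> T u)"

text \<open>
  As \<open>T\<close> may have a kernel, the form \<open>u \<bullet> T v\<close> is only a semi-inner product; the discriminant of
  \<open>t \<mapsto> (u + t v) \<bullet> T (u + t v)\<close> still has the right sign.
\<close>

lemma psd_cauchy_schwarz:
  assumes "psd_operator T"
  shows "(u \<bullet> T v)\<^sup>2 \<le> (u \<bullet> T u) * (v \<bullet> T v)"
proof -
  have lin: "linear T" and sym: "\<And>u v. T u \<bullet> v = u \<bullet> T v" and pos: "\<And>u. 0 \<le> u \<bullet> T u"
    using assms by (auto simp: psd_operator_def)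
  define a b c where "a = u \<bullet> T u" and "b = u \<bullet> T v" and "c = v \<bullet> T v"
  have "v \<bullet> T u = b"
    by (metis b_def inner_commute sym)
  then have quad: "0 \<le> a + 2 * t * b + t\<^sup>2 * c" for t
    using pos[of "u + t *\<^sub>R v"] lin
    by (simp add: linear_add linear_scale inner_add_left inner_add_right a_def b_def c_def
        power2_eq_square algebra_simps)
  show ?thesis
  proof (cases "c = 0")
    case True
    \<comment> \<open>the quadratic in \<open>t\<close> degenerates to an affine function, which is bounded below only if constant\<close>
    have "b = 0"
    proof (rule ccontr)
      assume "b \<noteq> 0"
      then show False
        using quad[of "- (a + 1) / (2 * b)"] True by (simp add: field_simps)
    qed
    then show ?thesis
      by (simp add: a_def b_def c_def[symmetric] True)
  next
    case False
    then have "c > 0"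
      using pos[of v] by (simp add: c_def)
    then have "b\<^sup>2 \<le> a * c"
      using quad[of "- b / c"] by (simp add: field_simps power2_eq_square)
    then show ?thesis
      by (simp add: a_def b_def c_def)
  qed
qed

text \<open>
  This turns smallness in the degenerate seminorm \<open>sqrt (u \<bullet> T u)\<close> into smallness of \<open>T u\<close>. It is
  Cauchy--Schwarz for the pair \<open>T u\<close>, \<open>u\<close>.
\<close>

lemma psd_norm_image:
  assumes T: "psd_operator T" and K: "\<And>u. u \<bullet> T u \<le> K * (norm u)\<^sup>2"
  shows "(norm (T u))\<^sup>2 \<le> K * (u \<bullet> T u)"
proof (cases "T u = 0")
  case True
  have "0 \<le> u \<bullet> T u" "0 \<le> K * (norm u)\<^sup>2"
    using T K[of u] by (force simp: psd_operator_def intro: order_trans)+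
  then show ?thesis
    using True by simp
next
  case False
  define s where "s = (norm (T u))\<^sup>2"
  have s: "s > 0" "T u \<bullet> T u = s"
    using False by (auto simp: s_def power2_norm_eq_inner)
  have pos: "0 \<le> u \<bullet> T u"
    using T by (simp add: psd_operator_def)
  have "s\<^sup>2 \<le> (T u \<bullet> T (T u)) * (u \<bullet> T u)"
    using psd_cauchy_schwarz[OF T, of "T u" u] s by simp
  also have "\<dots> \<le> (K * s) * (u \<bullet> T u)"
    using K[of "T u"] pos by (auto simp: s_def intro: mult_right_mono)
  finally have "s * s \<le> s * (K * (u \<bullet> T u))"
    by (simp add: power2_eq_square algebra_simps)
  then have "s \<le> K * (u \<bullet> T u)"
    using s(1) by (rule mult_left_le_imp_le)
  then show ?thesis
    by (simp add: s_def)
qed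

lemma quadratic_form_le_onorm:
  assumes "bounded_linear T"
  shows "u \<bullet> T u \<le> onorm T * (norm u)\<^sup>2"
proof -
  have "u \<bullet> T u \<le> norm u * norm (T u)"
    by (rule norm_cauchy_schwarz)
  also have "\<dots> \<le> norm u * (onorm T * norm u)"
    by (intro mult_left_mono onorm assms norm_ge_zero)
  finally show ?thesis
    by (simp add: power2_eq_square algebra_simps)
qed

lemma psd_operator_matrix:
  assumes "symmetric_matrix A" "pos_semidef A"
  shows "psd_operator ((*v) A)"
  using assms symmetric_inner by (auto simp: psd_operator_def pos_semidef_def)

lemma pos_def_imp_pos_semidef: "pos_def A \<Longrightarrow> pos_semidef A"
  unfolding pos_def_def pos_semidef_def
  by (metis inner_zero_left order.refl order.strict_implies_order)

lemma pos_def_invertible: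
  assumes "pos_def A"
  shows "A ** matrix_inv A = mat 1" "matrix_inv A ** A = mat 1"
proof -
  have "A *v x = 0 \<longrightarrow> x = 0" for x
    using assms by (metis pos_def_def inner_zero_right less_irrefl)
  then have "invertible A"
    by (simp add: invertible_left_inverse matrix_left_invertible_ker)
  then have "\<exists>A'. A ** A' = mat 1 \<and> A' ** A = mat 1"
    by (simp add: invertible_def)
  then have "A ** matrix_inv A = mat 1 \<and> matrix_inv A ** A = mat 1"
    unfolding matrix_inv_def by (rule someI_ex)
  then show "A ** matrix_inv A = mat 1" "matrix_inv A ** A = mat 1"
    by auto
qed

section \<open>Square roots of positive definite matrices\<close>

lemma pos_def_lower_bound:
  fixes A :: "real^'n^'n"
  assumes "pos_def A"
  obtains m where "m > 0" "\<And>u. m * (norm u)\<^sup>2 \<le> u \<bullet> (A *v u)"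
proof -
  have "sphere (0::real^'n) 1 \<noteq> {}"
    by simp
  moreover have "continuous_on (sphere 0 1) (\<lambda>u. u \<bullet> (A *v u))"
    by (intro continuous_intros)
  ultimately obtain w where w: "w \<in> sphere 0 1"
    and min: "\<And>u. u \<in> sphere 0 1 \<Longrightarrow> w \<bullet> (A *v w) \<le> u \<bullet> (A *v u)"
    using continuous_attains_inf[of "sphere 0 1" "\<lambda>u. u \<bullet> (A *v u)"] by (auto simp: compact_sphere)
  have "w \<noteq> 0"
    using w by auto
  moreover have "w \<bullet> (A *v w) * (norm u)\<^sup>2 \<le> u \<bullet> (A *v u)" for u
  proof (cases "u = 0")
    case False
    then show ?thesis
      using min[of "(1 / norm u) *\<^sub>R u"]
      by (simp add: matrix_vector_mult_scaleR power2_eq_square field_simps)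
  qed simp
  ultimately show ?thesis
    using that assms by (metis pos_def_def)
qed

text \<open>
  The equation for \<open>X\<close> says \<open>(1 - X)\<^sup>2 = 1 - E\<close>. On the self-adjoint operators of norm at most
  \<open>\<rho>\<close> the map \<open>X \<mapsto> (E + X\<^sup>2) / 2\<close> is a contraction, since
  \<open>X\<^sup>2 - Y\<^sup>2 = X (X - Y) + (X - Y) Y\<close> holds without commutativity; its fixed point is \<open>X\<close>.
  In this way a square root is obtained without diagonalising.
\<close>

lemma blinfun_sqrt_of_one_minus:
  fixes E :: "'a::euclidean_space \<Rightarrow>\<^sub>L 'a"
  assumes E: "norm E \<le> \<rho>" and \<rho>: "\<rho> < 1" and sym: "\<And>u v. E u \<bullet> v = u \<bullet> E v"
  obtains X :: "'a \<Rightarrow>\<^sub>L 'a" where "norm X \<le> \<rho>" "\<And>u v. X u \<bullet> v = u \<bullet> X v"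
    "\<And>u. 2 *\<^sub>R X u = E u + X (X u)"
proof -
  define \<Phi> where "\<Phi> X = (1/2) *\<^sub>R (E + (X o\<^sub>L X))" for X :: "'a \<Rightarrow>\<^sub>L 'a"
  define S where "S = {X :: 'a \<Rightarrow>\<^sub>L 'a. norm X \<le> \<rho> \<and>
    (\<forall>u v. blinfun_apply X u \<bullet> v = u \<bullet> blinfun_apply X v)}"
  have \<rho>0: "0 \<le> \<rho>"
    using E norm_ge_zero order_trans by blast
  have "closed S"
    unfolding S_def
    by (intro closed_Collect_conj closed_Collect_all closed_Collect_le closed_Collect_eq
        continuous_intros)
  then have "complete S"
    by (simp add: complete_eq_closed)
  moreover have "S \<noteq> {}"
    using \<rho>0 by (auto simp: S_def intro!: exI[of _ 0])
  moreover have "\<Phi> ` S \<subseteq> S"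
  proof (intro image_subsetI)
    fix X assume "X \<in> S"
    then have X: "norm X \<le> \<rho>" and symX: "\<And>u v. X u \<bullet> v = u \<bullet> X v"
      by (auto simp: S_def)
    have "norm (X o\<^sub>L X) \<le> \<rho> * \<rho>"
      by (rule order_trans[OF norm_blinfun_compose]) (intro mult_mono X \<rho>0 norm_ge_zero)
    also have "\<dots> \<le> \<rho>"
      using \<rho> \<rho>0 by (simp add: mult_left_le)
    finally have "norm (E + (X o\<^sub>L X)) \<le> 2 * \<rho>"
      using E norm_triangle_ineq[of E "X o\<^sub>L X"] by linarith
    then show "\<Phi> X \<in> S"
      by (simp add: S_def \<Phi>_def blinfun.bilinear_simps inner_simps sym symX)
  qed
  moreover have "dist (\<Phi> X) (\<Phi> Y) \<le> \<rho> * dist X Y" if "X \<in> S" "Y \<in> S" for X Y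
  proof -
    have XY: "norm X \<le> \<rho>" "norm Y \<le> \<rho>"
      using that by (auto simp: S_def)
    have "\<Phi> X - \<Phi> Y = (1/2) *\<^sub>R ((X o\<^sub>L (X - Y)) + ((X - Y) o\<^sub>L Y))"
      by (rule blinfun_eqI) (simp add: \<Phi>_def blinfun.bilinear_simps algebra_simps)
    then have "norm (\<Phi> X - \<Phi> Y) \<le> (1/2) * (norm (X o\<^sub>L (X - Y)) + norm ((X - Y) o\<^sub>L Y))"
      by (simp add: norm_triangle_ineq)
    also have "\<dots> \<le> (1/2) * (\<rho> * norm (X - Y) + norm (X - Y) * \<rho>)"
      by (intro mult_left_mono add_mono order_trans[OF norm_blinfun_compose] mult_mono XY \<rho>0) auto
    finally show ?thesis
      by (simp add: dist_norm)
  qed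
  ultimately have "\<exists>!X\<in>S. \<Phi> X = X"
    by (rule Banach_fix[OF _ _ \<rho>0 \<rho>])
  then obtain X where "X \<in> S" and fix_eq: "\<Phi> X = X"
    by (elim ex1E conjE)
  have "2 *\<^sub>R X u = E u + X (X u)" for u
    by (subst fix_eq[symmetric]) (simp add: \<Phi>_def blinfun.bilinear_simps)
  with that \<open>X \<in> S\<close> show ?thesis
    by (auto simp: S_def)
qed

text \<open>
  With \<open>m\<close> and \<open>c\<close> the lower and upper bounds of the quadratic form of \<open>A\<close>, the matrix
  \<open>E = 1 - A / c\<close> is positive semidefinite of norm at most \<open>1 - m / c < 1\<close>. If \<open>(1 - X)\<^sup>2 = 1 - E\<close>
  then \<open>sqrt c (1 - X)\<close> is a root of \<open>A\<close>, and it is positive definite because \<open>X\<close> has norm below \<open>1\<close>.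
\<close>

lemma pos_def_sqrt_exists:
  fixes A :: "real^'n^'n"
  assumes A: "symmetric_matrix A" "pos_def A"
  shows "\<exists>S. symmetric_matrix S \<and> pos_def S \<and> S ** S = A"
proof -
  obtain m where m: "m > 0" "\<And>u. m * (norm u)\<^sup>2 \<le> u \<bullet> (A *v u)"
    using pos_def_lower_bound[OF A(2)] by blast
  define c where "c = onorm ((*v) A)"
  have ub: "u \<bullet> (A *v u) \<le> c * (norm u)\<^sup>2" for u
    unfolding c_def by (intro quadratic_form_le_onorm matrix_vector_mul_bounded_linear)
  obtain e :: "real^'n" where e: "norm e = 1"
    using norm_axis_1 by blast
  have mc: "m \<le> c"
    using order_trans[OF m(2) ub, of e] e by simp
  with m have c: "c > 0"
    by simp
  define \<rho> where "\<rho> = 1 - m / c"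
  have \<rho>: "0 \<le> \<rho>" "\<rho> < 1"
    using m mc c by (auto simp: \<rho>_def)
  define E where "E = mat 1 - (1 / c) *\<^sub>R A"
  have E_mv: "E *v u = u - (1 / c) *\<^sub>R (A *v u)" for u
    by (simp add: E_def matrix_vector_mult_diff_rdistrib scaleR_matrix_vector_assoc)
  have psdE: "psd_operator ((*v) E)"
    using ub c by (auto simp: psd_operator_def E_mv inner_simps symmetric_inner[OF A(1)]
        power2_norm_eq_inner field_simps)
  have Eub: "u \<bullet> (E *v u) \<le> \<rho> * (norm u)\<^sup>2" for u
    using m(2)[of u] c
    by (simp add: E_mv inner_simps \<rho>_def power2_norm_eq_inner field_simps)
  have "norm (E *v u) \<le> \<rho> * norm u" for u
  proof (rule power2_le_imp_le)
    have "(norm (E *v u))\<^sup>2 \<le> \<rho> * (u \<bullet> (E *v u))"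
      by (rule psd_norm_image[OF psdE Eub])
    also have "\<dots> \<le> \<rho> * (\<rho> * (norm u)\<^sup>2)"
      by (rule mult_left_mono[OF Eub \<rho>(1)])
    finally show "(norm (E *v u))\<^sup>2 \<le> (\<rho> * norm u)\<^sup>2"
      by (simp add: power2_eq_square algebra_simps)
  qed (use \<rho> in simp)
  moreover have app: "blinfun_apply (Blinfun ((*v) E)) = (*v) E"
    by (simp add: bounded_linear_Blinfun_apply matrix_vector_mul_bounded_linear)
  ultimately have "norm (Blinfun ((*v) E)) \<le> \<rho>"
    by (intro norm_blinfun_bound) (use \<rho> in auto)
  then obtain X :: "(real^'n) \<Rightarrow>\<^sub>L (real^'n)" where X: "norm X \<le> \<rho>" "\<And>u v. X u \<bullet> v = u \<bullet> X v"
    "\<And>u. 2 *\<^sub>R X u = E *v u + X (X u)"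
    using blinfun_sqrt_of_one_minus[of "Blinfun ((*v) E)" \<rho>] \<rho> psdE app
    by (metis psd_operator_def)
  have "linear (\<lambda>u. sqrt c *\<^sub>R (u - X u))"
    by (rule linearI) (simp_all add: blinfun.bilinear_simps algebra_simps)
  then obtain S :: "real^'n^'n" where S: "\<And>u. S *v u = sqrt c *\<^sub>R (u - X u)"
    using matrix_vector_mul(2) by metis
  have "symmetric_matrix S"
    by (rule inner_symmetric_matrix) (simp add: S inner_simps X(2))
  moreover have "pos_def S"
    unfolding pos_def_def
  proof (intro allI impI)
    fix u :: "real^'n" assume "u \<noteq> 0"
    have "u \<bullet> X u \<le> norm u * norm (X u)"
      by (rule norm_cauchy_schwarz)
    also have "\<dots> \<le> norm u * (\<rho> * norm u)"
      by (intro mult_left_mono order_trans[OF norm_blinfun] mult_right_mono X) auto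
    also have "\<dots> < norm u * norm u"
      using \<rho> \<open>u \<noteq> 0\<close> by simp
    finally show "0 < u \<bullet> (S *v u)"
      using c by (simp add: S inner_simps power2_norm_eq_inner flip: power2_eq_square)
  qed
  moreover have "S ** S = A"
  proof (subst matrix_eq, intro allI)
    fix u
    have "S *v (S *v u) = c *\<^sub>R (u - 2 *\<^sub>R X u + X (X u))"
      using c by (simp add: S blinfun.bilinear_simps algebra_simps scaleR_2)
    also have "\<dots> = A *v u"
      unfolding X(3) using c by (simp add: E_mv)
    finally show "(S ** S) *v u = A *v u"
      by (simp add: matrix_vector_mul_assoc)
  qed
  ultimately show ?thesis
    by blast
qed

text \<open>
  If \<open>D\<close> is the difference of two roots then \<open>S D + D R = S\<^sup>2 - R\<^sup>2 = 0\<close>. Multiplying by \<open>D\<close> and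
  taking traces gives \<open>tr (D S D) + tr (D R D) = 0\<close>, where both summands are nonnegative, and
  vanish only for \<open>D = 0\<close>.
\<close>

lemma pos_def_sqrt_unique:
  fixes S R :: "real^'n^'n"
  assumes S: "symmetric_matrix S" "pos_def S" and R: "symmetric_matrix R" "pos_def R"
    and eq: "S ** S = R ** R"
  shows "S = R"
proof -
  define D where "D = S - R"
  have D: "transpose D = D"
    using S(1) R(1) by (simp add: D_def symmetric_matrix_def transpose_def vec_eq_iff)
  have congruence: "trace (D ** (C ** D)) = (\<Sum>i\<in>UNIV. column i D \<bullet> (C *v column i D))" for C
  proof -
    have "(D ** (C ** D)) $ i $ i = column i D \<bullet> (C *v column i D)" for i
    proof -
      have "(D ** (C ** D)) $ i $ i = axis i 1 \<bullet> ((D ** (C ** D)) *v axis i 1)"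
        by (simp add: inner_axis' matrix_vector_mult_basis column_def)
      also have "\<dots> = (D *v axis i 1) \<bullet> (C *v (D *v axis i 1))"
        using D by (metis dot_lmul_matrix transpose_matrix_vector matrix_vector_mul_assoc)
      finally show ?thesis
        by (simp add: matrix_vector_mult_basis)
    qed
    then show ?thesis
      by (simp add: trace_def)
  qed
  have "S ** D + D ** R = 0"
    using eq
    by (simp add: matrix_eq D_def matrix_vector_mult_add_rdistrib matrix_vector_mult_diff_rdistrib
        matrix_vector_mult_diff_distrib flip: matrix_vector_mul_assoc)
  then have "trace (D ** (S ** D) + D ** (D ** R)) = 0"
    by (simp add: trace_def flip: matrix_add_ldistrib)
  moreover have "trace (D ** (D ** R)) = trace (D ** (R ** D))"
    using trace_mul_sym[of D "D ** R"] by (simp add: matrix_mul_assoc)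
  ultimately have "(\<Sum>i\<in>UNIV. column i D \<bullet> (S *v column i D) + column i D \<bullet> (R *v column i D)) = 0"
    by (simp add: congruence sum.distrib trace_add)
  moreover have "0 \<le> column i D \<bullet> (S *v column i D)" "0 \<le> column i D \<bullet> (R *v column i D)" for i
    using S(2) R(2) pos_def_imp_pos_semidef pos_semidef_def by blast+
  ultimately have "column i D \<bullet> (S *v column i D) + column i D \<bullet> (R *v column i D) = 0" for i
    by (subst (asm) sum_nonneg_eq_0_iff) auto
  then have "column i D = 0" for i
    using S(2) R(2) by (metis add_pos_pos less_irrefl pos_def_def)
  then have "D = 0"
    by (simp add: column_def vec_eq_iff)
  then show ?thesis
    by (simp add: D_def)
qed

lemma matrix_sqrt:
  assumes "symmetric_matrix A" "pos_def A"
  shows "symmetric_matrix (matrix_sqrt A)" "pos_def (matrix_sqrt A)"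
    "matrix_sqrt A ** matrix_sqrt A = A"
proof -
  have "\<exists>!S. symmetric_matrix S \<and> pos_def S \<and> S ** S = A"
    using pos_def_sqrt_exists[OF assms] pos_def_sqrt_unique by blast
  from theI'[OF this]
  show "symmetric_matrix (matrix_sqrt A)" "pos_def (matrix_sqrt A)"
    "matrix_sqrt A ** matrix_sqrt A = A"
    by (auto simp: matrix_sqrt_def)
qed

lemma norm_matrix_sqrt:
  assumes "symmetric_matrix A" "pos_def A"
  shows "(norm (matrix_sqrt A *v u))\<^sup>2 = u \<bullet> (A *v u)"
  using matrix_sqrt[OF assms] symmetric_inner
  by (metis power2_norm_eq_inner matrix_vector_mul_assoc)

text \<open>
  The condition on the preconditioned norm enters the convergence proof only in this form: the
  block matrix with diagonal blocks \<open>P\<close>, \<open>Q\<close> and off-diagonal blocks \<open>L\<^sup>T\<close>, \<open>L\<close> is positive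
  semidefinite.
\<close>

lemma bilinear_bound_of_spectral_norm:
  fixes L :: "real^'n^'m"
  assumes P: "symmetric_matrix P" "pos_def P" and Q: "symmetric_matrix Q" "pos_def Q"
    and norm_le: "spectral_norm (matrix_inv_sqrt Q ** L ** matrix_inv_sqrt P) \<le> 1"
  shows "- 2 * (v \<bullet> (L *v u)) \<le> u \<bullet> (P *v u) + v \<bullet> (Q *v v)"
proof -
  define N where "N = matrix_inv_sqrt Q ** L ** matrix_inv_sqrt P"
  define p where "p = matrix_sqrt P *v u"
  define r where "r = matrix_sqrt Q *v v"
  have "matrix_sqrt Q ** N ** matrix_sqrt P
      = (matrix_sqrt Q ** matrix_inv (matrix_sqrt Q)) ** L
        ** (matrix_inv (matrix_sqrt P) ** matrix_sqrt P)"
    by (simp add: N_def matrix_inv_sqrt_def matrix_mul_assoc)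
  also have "\<dots> = L"
    using pos_def_invertible matrix_sqrt P Q by (metis matrix_mul_lid matrix_mul_rid)
  finally have "L *v u = matrix_sqrt Q *v (N *v p)"
    by (metis matrix_vector_mul_assoc p_def)
  then have "v \<bullet> (L *v u) = r \<bullet> (N *v p)"
    using symmetric_inner[OF matrix_sqrt(1)[OF Q]] by (simp add: r_def)
  moreover have "\<bar>r \<bullet> (N *v p)\<bar> \<le> norm r * norm (N *v p)"
    by (rule Cauchy_Schwarz_ineq2)
  moreover have "norm (N *v p) \<le> norm p"
    using onorm[OF matrix_vector_mul_bounded_linear, of N p] norm_le
    by (metis N_def spectral_norm_def mult_right_mono norm_ge_zero mult_1 order_trans)
  then have "norm r * norm (N *v p) \<le> norm r * norm p"
    by (simp add: mult_left_mono)
  moreover have "2 * (norm r * norm p) \<le> (norm r)\<^sup>2 + (norm p)\<^sup>2"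
    using sum_squares_bound[of "norm r" "norm p"] by simp
  ultimately show ?thesis
    using norm_matrix_sqrt[OF P, of u] norm_matrix_sqrt[OF Q, of v]
    by (simp add: p_def r_def)
qed

section \<open>Degenerate proximal point iterations\<close>

text \<open>
  The model is a monotone operator \<open>\<A>\<close> with \<open>F = (M + \<A>)\<^sup>-\<^sup>1\<close>, whose zeros form \<open>Z\<close>: then \<open>u\<^sub>n\<^sub>+\<^sub>1\<close>
  solves \<open>M (u\<^sub>n - u\<^sub>n\<^sub>+\<^sub>1) \<in> \<A> u\<^sub>n\<^sub>+\<^sub>1\<close>, and the last hypothesis is monotonicity of \<open>\<A>\<close> between
  \<open>u\<^sub>n\<^sub>+\<^sub>1\<close> and a zero. In the seminorm \<open>q\<close> of \<open>M\<close>, the distances to any zero do not increase and the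
  steps tend to \<open>0\<close>. As \<open>M\<close> may be singular, this controls only the images \<open>M u\<^sub>n\<close>. These suffice,
  because \<open>u\<^sub>n\<^sub>+\<^sub>1\<close> is a continuous function of \<open>M u\<^sub>n\<close>: a cluster point \<open>w\<close> of the images gives
  a cluster point \<open>z = F w\<close> of the sequence, which is a fixed point, and the monotone distance to
  \<open>z\<close> then tends to \<open>0\<close>.
\<close>

lemma degenerate_proximal_point_converges:
  fixes M F :: "'a::euclidean_space \<Rightarrow> 'a" and u :: "nat \<Rightarrow> 'a"
  assumes M: "psd_operator M"
    and F: "continuous_on UNIV F"
    and step: "\<And>n. u (Suc n) = F (M (u n))"
    and Z: "z0 \<in> Z" "\<And>z. F (M z) = z \<Longrightarrow> z \<in> Z"
    and monotone: "\<And>z v. z \<in> Z \<Longrightarrow> 0 \<le> M (v - F (M v)) \<bullet> (F (M v) - z)"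
  obtains z where "F (M z) = z" "u \<longlonglongrightarrow> z"
proof -
  have lin: "linear M" and sym: "\<And>v w. M v \<bullet> w = v \<bullet> M w"
    using M by (auto simp: psd_operator_def)
  then have bl: "bounded_linear M"
    by (simp add: linear_conv_bounded_linear)
  define q where "q v = v \<bullet> M v" for v
  define K where "K = onorm M"
  have q_nonneg: "0 \<le> q v" for v
    using M by (simp add: psd_operator_def q_def)
  have K: "(norm (M v))\<^sup>2 \<le> K * q v" for v
    unfolding K_def q_def by (intro psd_norm_image M quadratic_form_le_onorm bl)
  have K_nonneg: "0 \<le> K"
    unfolding K_def by (rule onorm_pos_le[OF bl])
  have M_tendsto: "(\<lambda>n. M (v n)) \<longlonglongrightarrow> 0" if "(\<lambda>n. q (v n)) \<longlonglongrightarrow> 0" for v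
  proof -
    have "(\<lambda>n. (norm (M (v n)))\<^sup>2) \<longlonglongrightarrow> 0"
    proof (rule tendsto_sandwich[OF _ _ tendsto_const])
      show "(\<lambda>n. K * q (v n)) \<longlonglongrightarrow> 0"
        using tendsto_mult_left[OF that, of K] by simp
    qed (auto simp: K)
    then have "(\<lambda>n. sqrt ((norm (M (v n)))\<^sup>2)) \<longlonglongrightarrow> sqrt 0"
      by (rule tendsto_real_sqrt)
    then show ?thesis
      by (simp add: tendsto_norm_zero_iff)
  qed
  \<comment> \<open>expand \<open>q\<close> along \<open>u n - z = (u n - u (Suc n)) + (u (Suc n) - z)\<close>; the mixed term is nonnegative\<close>
  have fejer: "q (u (Suc n) - z) + q (u n - u (Suc n)) \<le> q (u n - z)" if "z \<in> Z" for n z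
  proof -
    define a where "a = u n - u (Suc n)"
    define e where "e = u (Suc n) - z"
    have "q (u n - z) = q (a + e)"
      by (simp add: a_def e_def)
    also have "\<dots> = q a + 2 * (M a \<bullet> e) + q e"
      using sym[of a e]
      by (simp add: q_def linear_add[OF lin] inner_simps inner_commute[of e "M a"])
    finally show ?thesis
      using monotone[OF that, of "u n"] by (simp add: step[symmetric] a_def e_def)
  qed
  have dec: "decseq (\<lambda>n. q (u n - z))" if "z \<in> Z" for z
    unfolding decseq_Suc_iff using fejer[OF that] q_nonneg
    by (metis add_increasing2 le_add_same_cancel1 order_trans)
  have conv: "convergent (\<lambda>n. q (u n - z))" if "z \<in> Z" for z
    using decseq_convergent[OF dec[OF that]] q_nonneg by (metis convergentI)
  have "(\<lambda>n. q (u n - u (Suc n))) \<longlonglongrightarrow> 0"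
  proof (rule tendsto_sandwich[OF _ _ tendsto_const])
    obtain l where l: "(\<lambda>n. q (u n - z0)) \<longlonglongrightarrow> l"
      using conv[OF Z(1)] by (auto simp: convergent_def)
    show "(\<lambda>n. q (u n - z0) - q (u (Suc n) - z0)) \<longlonglongrightarrow> 0"
      using tendsto_diff[OF l LIMSEQ_Suc[OF l]] by simp
    show "\<forall>\<^sub>F n in sequentially. q (u n - u (Suc n)) \<le> q (u n - z0) - q (u (Suc n) - z0)"
      using fejer[OF Z(1)] by (simp add: algebra_simps)
  qed (simp add: q_nonneg)
  then have "(\<lambda>n. M (u n - u (Suc n))) \<longlonglongrightarrow> 0"
    by (rule M_tendsto)
  then have asym_regular: "(\<lambda>n. M (u n) - M (u (Suc n))) \<longlonglongrightarrow> 0"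
    by (simp add: linear_diff[OF lin])
  have "norm (M (u n)) \<le> sqrt (K * q (u 0 - z0)) + norm (M z0)" for n
  proof -
    have "(norm (M (u n - z0)))\<^sup>2 \<le> K * q (u 0 - z0)"
      using K[of "u n - z0"] decseqD[OF dec[OF Z(1)], of 0 n] K_nonneg
      by (meson mult_left_mono order_trans zero_le)
    then have "norm (M (u n) - M z0) \<le> sqrt (K * q (u 0 - z0))"
      by (simp add: real_le_rsqrt linear_diff[OF lin])
    then show ?thesis
      using norm_triangle_sub[of "M (u n)" "M z0"] by simp
  qed
  then have "bounded (range (\<lambda>n. M (u n)))"
    unfolding bounded_iff by blast
  then obtain w r where r: "strict_mono r" and w: "(\<lambda>j. M (u (r j))) \<longlonglongrightarrow> w"
    using bounded_imp_convergent_subsequence[of "\<lambda>n. M (u n)"] by (auto simp: comp_def)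
  define z where "z = F w"
  have F_tendsto: "(\<lambda>n. F (v n)) \<longlonglongrightarrow> F l" if "v \<longlonglongrightarrow> l" for v l
    using continuous_on_tendsto_compose[OF F that] by simp
  have sub: "(\<lambda>j. u (Suc (r j))) \<longlonglongrightarrow> z"
    unfolding step z_def by (rule F_tendsto[OF w])
  then have "(\<lambda>j. M (u (Suc (r j)))) \<longlonglongrightarrow> M z"
    by (rule bounded_linear.tendsto[OF bl])
  moreover have "(\<lambda>j. M (u (Suc (r j)))) \<longlonglongrightarrow> w"
    using tendsto_diff[OF w LIMSEQ_subseq_LIMSEQ[OF asym_regular r]] by (simp add: comp_def)
  \<comment> \<open>both limits hold for the same sequence, as consecutive images become equal in the limit\<close>
  ultimately have "w = M z"
    using LIMSEQ_unique by blast
  then have fixed: "F (M z) = z"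
    by (simp add: z_def)
  obtain l where l: "(\<lambda>n. q (u n - z)) \<longlonglongrightarrow> l"
    using conv[OF Z(2)[OF fixed]] by (auto simp: convergent_def)
  have "(\<lambda>j. q (u (Suc (r j)) - z)) \<longlonglongrightarrow> q (z - z)"
    unfolding q_def by (intro tendsto_inner tendsto_diff sub tendsto_const bounded_linear.tendsto[OF bl])
  moreover have "(\<lambda>j. q (u (Suc (r j)) - z)) \<longlonglongrightarrow> l"
    using LIMSEQ_subseq_LIMSEQ[OF LIMSEQ_Suc[OF l] r] by (simp add: comp_def)
  ultimately have "l = q 0"
    using LIMSEQ_unique by fastforce
  then have "(\<lambda>n. q (u n - z)) \<longlonglongrightarrow> 0"
    using l by (simp add: q_def)
  then have "(\<lambda>n. M (u n) - M z) \<longlonglongrightarrow> 0"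
    using M_tendsto by (simp flip: linear_diff[OF lin])
  then have "(\<lambda>n. M (u n)) \<longlonglongrightarrow> M z"
    using LIM_zero_iff by blast
  then have "(\<lambda>n. u (Suc n)) \<longlonglongrightarrow> z"
    unfolding step using F_tendsto fixed by metis
  then show ?thesis
    using that[OF fixed] LIMSEQ_imp_Suc by blast
qed

section \<open>Minimisers and saddle points\<close>

definition penalised_quadratic ::
    "real^'n^'n \<Rightarrow> real^'n \<Rightarrow> real^'n^'m \<Rightarrow> real^'m \<Rightarrow> real^'n \<Rightarrow> real" where
  "penalised_quadratic B b L d z = z \<bullet> (B *v z) + b \<bullet> z + l1_norm (L *v z - d)"

text \<open>
  The saddle points on \<open>\<real>\<^sup>n \<times> [-\<alpha>,\<alpha>]\<^sup>m\<close> of the Lagrangian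
  \<open>\<alpha> (x \<bullet> B x + b \<bullet> x) + y \<bullet> (L x - d)\<close>, for symmetric \<open>B\<close>: the \<open>x\<close>-gradient vanishes, and
  \<open>y\<close> attains the maximum \<open>\<alpha> |L x - d|\<^sub>1\<close> over the box, coordinate by coordinate.
\<close>

definition saddle_point ::
    "real \<Rightarrow> real^'n^'n \<Rightarrow> real^'n \<Rightarrow> real^'n^'m \<Rightarrow> real^'m \<Rightarrow> real^'n \<Rightarrow> real^'m \<Rightarrow> bool" where
  "saddle_point \<alpha> B b L d x y \<longleftrightarrow>
     (2 * \<alpha>) *\<^sub>R (B *v x) + \<alpha> *\<^sub>R b + y v* L = 0 \<and>
     (\<forall>i. y $ i \<in> {-\<alpha>..\<alpha>} \<and> y $ i * (L *v x - d) $ i = \<alpha> * \<bar>(L *v x - d) $ i\<bar>)"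

lemma quadratic_form_add:
  assumes "symmetric_matrix B"
  shows "(u + v) \<bullet> (B *v (u + v)) = u \<bullet> (B *v u) + 2 * ((B *v u) \<bullet> v) + v \<bullet> (B *v v)"
  using symmetric_inner[OF assms, of u v]
  by (simp add: matrix_vector_right_distrib inner_add_left inner_add_right inner_commute)

lemma continuous_penalised_quadratic: "continuous_on S (penalised_quadratic B b L d)"
  unfolding penalised_quadratic_def l1_norm_def by (intro continuous_intros)

text \<open>
  The objective need not be coercive, but it does not change along \<open>ker B \<inter> ker L\<close>: a linear form that
  keeps the quadratic part bounded below vanishes on \<open>ker B\<close>. On the orthogonal complement,
  sublevel sets bound both \<open>B z\<close> and \<open>L z\<close>, hence \<open>z\<close>. Evaluating the lower bound at \<open>z / 2\<close>
  shows that \<open>b \<bullet> z\<close> absorbs at most half of \<open>z \<bullet> B z\<close>, up to a constant,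
  which gives the bound on \<open>B z\<close>.
\<close>

lemma penalised_quadratic_attains_min:
  fixes B :: "real^'n^'n" and L :: "real^'n^'m"
  assumes B: "symmetric_matrix B" "pos_semidef B"
    and bounded_below: "\<And>z. - c \<le> z \<bullet> (B *v z) + b \<bullet> z"
  obtains xs where "\<And>z. penalised_quadratic B b L d xs \<le> penalised_quadratic B b L d z"
proof -
  let ?\<phi> = "penalised_quadratic B b L d"
  define K where "K = {z. B *v z = 0 \<and> L *v z = 0}"
  have subK: "subspace K"
    by (auto simp: K_def subspace_def matrix_vector_right_distrib matrix_vector_mult_scaleR)
  have b_orth: "b \<bullet> k = 0" if "k \<in> K" for k
  proof (rule ccontr)
    assume "b \<bullet> k \<noteq> 0"
    then show False
      using bounded_below[of "(- (c + 1) / (b \<bullet> k)) *\<^sub>R k"] that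
      by (simp add: K_def matrix_vector_mult_scaleR)
  qed
  have invariant: "?\<phi> (k + w) = ?\<phi> w" if "k \<in> K" for k w
  proof -
    have "k \<bullet> (B *v w) = 0"
      using that by (simp add: K_def flip: symmetric_inner[OF B(1)])
    then show ?thesis
      using that b_orth[OF that]
      by (simp add: penalised_quadratic_def K_def matrix_vector_right_distrib inner_simps)
  qed
  define G where "G z = (B *v z, L *v z)" for z
  have G: "bounded_linear G"
    unfolding G_def by (intro bounded_linear_Pair matrix_vector_mul_bounded_linear)
  have "\<forall>z\<in>K\<^sup>\<bottom>. G z = 0 \<longrightarrow> z = 0"
    by (auto simp: G_def K_def orthogonal_comp_def orthogonal_def prod_eq_iff)
  then obtain e where e: "e > 0" "\<And>z. z \<in> K\<^sup>\<bottom> \<Longrightarrow> e * norm z \<le> norm (G z)"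
    using injective_imp_isometric[OF closed_subspace[OF subspace_orthogonal_comp]
        subspace_orthogonal_comp G] by blast
  define S where "S = {z \<in> K\<^sup>\<bottom>. ?\<phi> z \<le> ?\<phi> 0}"
  define C where "C = 2 * (l1_norm d + 2 * c)"
  define C' where "C' = sqrt (onorm ((*v) B) * C) + C + norm d"
  have "norm z \<le> C' / e" if "z \<in> S" for z
  proof -
    define s where "s = z \<bullet> (B *v z)"
    have s: "0 \<le> s"
      using B(2) by (simp add: pos_semidef_def s_def)
    have l1: "norm (L *v z - d) \<le> l1_norm (L *v z - d)"
      unfolding l1_norm_def by (rule norm_le_l1_cart)
    have lower: "- (1/2) * s - 2 * c \<le> b \<bullet> z"
      using bounded_below[of "(1/2) *\<^sub>R z"] by (simp add: matrix_vector_mult_scaleR s_def)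
    have "s + b \<bullet> z + l1_norm (L *v z - d) \<le> l1_norm d"
      using that by (simp add: S_def penalised_quadratic_def s_def l1_norm_def)
    with lower have sum_le: "(1/2) * s + l1_norm (L *v z - d) \<le> C / 2"
      by (simp add: C_def)
    have sC: "s \<le> C"
      using sum_le l1 norm_ge_zero[of "L *v z - d"] by linarith
    have "(norm (B *v z))\<^sup>2 \<le> onorm ((*v) B) * s"
      unfolding s_def
      by (intro psd_norm_image psd_operator_matrix B quadratic_form_le_onorm
          matrix_vector_mul_bounded_linear)
    also have "\<dots> \<le> onorm ((*v) B) * C"
      by (intro mult_left_mono sC onorm_pos_le matrix_vector_mul_bounded_linear)
    finally have "norm (B *v z) \<le> sqrt (onorm ((*v) B) * C)"
      by (rule real_le_rsqrt)
    moreover have "norm (L *v z) \<le> C + norm d"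
      using norm_triangle_sub[of "L *v z" d] l1 sum_le s sC by linarith
    ultimately have "norm (G z) \<le> C'"
      using norm_Pair_le[of "B *v z" "L *v z"] by (simp add: G_def C'_def)
    then have "e * norm z \<le> C'"
      using e(2)[of z] that by (simp add: S_def)
    then show ?thesis
      using e(1) by (simp add: field_simps)
  qed
  then have "bounded S"
    unfolding bounded_iff by blast
  moreover have "closed S"
  proof -
    have "S = K\<^sup>\<bottom> \<inter> {z. ?\<phi> z \<le> ?\<phi> 0}"
      by (auto simp: S_def)
    then show ?thesis
      by (simp only:) (intro closed_Int closed_subspace subspace_orthogonal_comp closed_Collect_le
          continuous_penalised_quadratic continuous_on_const)
  qed
  ultimately have "compact S"
    by (simp add: compact_eq_bounded_closed)
  moreover have "0 \<in> S"
    by (simp add: S_def subspace_0[OF subspace_orthogonal_comp])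
  ultimately obtain xs where xs: "xs \<in> S" "\<And>z. z \<in> S \<Longrightarrow> ?\<phi> xs \<le> ?\<phi> z"
    using continuous_attains_inf[of S ?\<phi>] continuous_penalised_quadratic by blast
  have "?\<phi> xs \<le> ?\<phi> z" for z
  proof -
    obtain k w where kw: "k \<in> K" "w \<in> K\<^sup>\<bottom>" "z = k + w"
      by (rule set_plus_elim[of z K "K\<^sup>\<bottom>"]) (auto simp: subspace_sum_orthogonal_comp[OF subK])
    have "?\<phi> xs \<le> ?\<phi> w"
    proof (cases "w \<in> S")
      case False
      then have "?\<phi> 0 \<le> ?\<phi> w"
        using kw by (simp add: S_def)
      then show ?thesis
        using xs(1) by (simp add: S_def)
    qed (rule xs(2))
    then show ?thesis
      using invariant[OF kw(1)] kw(3) by simp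
  qed
  then show ?thesis
    using that by blast
qed

text \<open>
  The multipliers compatible with the residual \<open>r\<close> form a box \<open>Y\<close>. If minus the gradient of the
  scaled quadratic part were outside the compact convex set \<open>L\<^sup>T Y\<close>, a separating hyperplane would
  provide a direction \<open>p\<close> in which the directional derivative of the objective is negative, as the
  derivative of its penalty part is the maximum of \<open>y \<bullet> L p\<close> over \<open>Y\<close>.
\<close>

lemma minimiser_has_multiplier:
  fixes B :: "real^'n^'n" and L :: "real^'n^'m"
  assumes B: "symmetric_matrix B" and \<alpha>: "\<alpha> > 0"
    and min: "\<And>z. penalised_quadratic B b L d xs \<le> penalised_quadratic B b L d z"
  obtains ys where "saddle_point \<alpha> B b L d xs ys"
proof -
  define r where "r = L *v xs - d"
  define c where "c = - ((2 * \<alpha>) *\<^sub>R (B *v xs) + \<alpha> *\<^sub>R b)"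
  define Y where "Y = cbox (\<chi> i. if r $ i > 0 then \<alpha> else - \<alpha>) (\<chi> i. if r $ i < 0 then - \<alpha> else \<alpha>)"
  have Y_eq: "y \<in> Y \<longleftrightarrow> (\<forall>i. y $ i \<in> {-\<alpha>..\<alpha>} \<and> y $ i * r $ i = \<alpha> * \<bar>r $ i\<bar>)" for y
  proof -
    have "(if r $ i > 0 then \<alpha> else - \<alpha>) \<le> y $ i \<and> y $ i \<le> (if r $ i < 0 then - \<alpha> else \<alpha>) \<longleftrightarrow>
        y $ i \<in> {-\<alpha>..\<alpha>} \<and> y $ i * r $ i = \<alpha> * \<bar>r $ i\<bar>" for i
      using \<alpha> mult_cancel_right[of "y $ i" "r $ i" "- \<alpha>"]
      by (cases "r $ i" "0::real" rule: linorder_cases) auto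
    then show ?thesis
      by (simp add: Y_def mem_box_cart)
  qed
  have "c \<in> (\<lambda>y. y v* L) ` Y"
  proof (rule ccontr)
    assume notin: "c \<notin> (\<lambda>y. y v* L) ` Y"
    have lin: "linear (\<lambda>y. y v* L)"
      using matrix_vector_mul_linear[of "transpose L"] by simp
    have "convex ((\<lambda>y. y v* L) ` Y)"
      unfolding Y_def by (intro convex_linear_image lin convex_box)
    moreover have "compact ((\<lambda>y. y v* L) ` Y)"
      unfolding Y_def by (intro compact_continuous_image compact_cbox linear_continuous_on
          linear_conv_bounded_linear[THEN iffD1] lin)
    ultimately obtain a \<beta> where a: "a \<bullet> c < \<beta>" "\<And>y. y \<in> Y \<Longrightarrow> \<beta> < a \<bullet> (y v* L)"
      using separating_hyperplane_closed_point[OF _ compact_imp_closed notin] by blast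
    define p where "p = - a"
    define s where "s = L *v p"
    \<comment> \<open>the multiplier in \<open>Y\<close> that stays exact on a short segment from \<open>xs\<close> in direction \<open>p\<close>: where
        the residual vanishes, its sign is taken from its rate of change\<close>
    define y where "y = (\<chi> i. \<alpha> * (if r $ i = 0 then sgn (s $ i) else sgn (r $ i)))"
    have "y \<in> Y"
      unfolding Y_eq y_def using \<alpha> by (auto simp: sgn_if)
    then have "a \<bullet> c < a \<bullet> (y v* L)"
      using a by (metis order_less_trans)
    then have descent: "y \<bullet> s - c \<bullet> p < 0"
      by (simp add: p_def s_def inner_commute dot_lmul_matrix flip: dot_lmul_matrix)
    have coord: "\<forall>\<^sub>F t in at_right 0. \<alpha> * \<bar>r $ i + t * s $ i\<bar> = y $ i * (r $ i + t * s $ i)" for i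
    proof (cases "r $ i = 0")
      case True
      then show ?thesis
        by (auto simp: y_def sgn_if abs_if mult_neg_pos mult_pos_neg
            zero_less_mult_iff mult_less_0_iff
            intro!: eventually_mono[OF eventually_at_right_less[of 0]])
    next
      case False
      have lim: "((\<lambda>t. r $ i + t * s $ i) \<longlongrightarrow> r $ i + 0 * s $ i) (at_right 0)"
        by (intro tendsto_intros)
      show ?thesis
      proof (cases "r $ i > 0")
        case True
        then have "\<forall>\<^sub>F t in at_right 0. 0 < r $ i + t * s $ i"
          using order_tendstoD(1)[OF lim, of 0] by simp
        then show ?thesis
          by eventually_elim (use True in \<open>simp add: y_def\<close>)
      next
        case neg: False
        then have "\<forall>\<^sub>F t in at_right 0. r $ i + t * s $ i < 0"
          using order_tendstoD(2)[OF lim, of 0] False by simp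
        then show ?thesis
          by eventually_elim (use neg False in \<open>simp add: y_def algebra_simps\<close>)
      qed
    qed
    have "\<forall>\<^sub>F t in at_right 0. \<forall>i. \<alpha> * \<bar>r $ i + t * s $ i\<bar> = y $ i * (r $ i + t * s $ i)"
      by (intro eventually_all_finite coord)
    then have "\<forall>\<^sub>F t in at_right 0. 0 \<le> y \<bullet> s - c \<bullet> p + t * (\<alpha> * (p \<bullet> (B *v p)))"
      using eventually_at_right_less[of "0::real"]
    proof eventually_elim
      case (elim t)
      have "L *v (xs + t *\<^sub>R p) - d = r + t *\<^sub>R s"
        by (simp add: r_def s_def matrix_vector_right_distrib matrix_vector_mult_scaleR)
      then have "\<alpha> * l1_norm (L *v (xs + t *\<^sub>R p) - d) = y \<bullet> (r + t *\<^sub>R s)"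
        using elim(1) by (simp add: l1_norm_def inner_vec_def sum_distrib_left)
      moreover have "\<alpha> * l1_norm (L *v xs - d) = y \<bullet> r"
        using \<open>y \<in> Y\<close> by (simp add: Y_eq l1_norm_def inner_vec_def sum_distrib_left flip: r_def)
      moreover have "\<alpha> * penalised_quadratic B b L d xs
          \<le> \<alpha> * penalised_quadratic B b L d (xs + t *\<^sub>R p)"
        using min \<alpha> by simp
      ultimately have "0 \<le> t * (y \<bullet> s - c \<bullet> p + t * (\<alpha> * (p \<bullet> (B *v p))))"
        unfolding penalised_quadratic_def quadratic_form_add[OF B]
        by (simp add: distrib_left c_def inner_simps matrix_vector_mult_scaleR algebra_simps)
      then show ?case
        using elim(2) by (simp add: zero_le_mult_iff)
    qed
    moreover have "((\<lambda>t. y \<bullet> s - c \<bullet> p + t * (\<alpha> * (p \<bullet> (B *v p))))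
        \<longlongrightarrow> y \<bullet> s - c \<bullet> p + 0 * (\<alpha> * (p \<bullet> (B *v p)))) (at_right 0)"
      by (intro tendsto_intros)
    ultimately have "0 \<le> y \<bullet> s - c \<bullet> p + 0 * (\<alpha> * (p \<bullet> (B *v p)))"
      by (intro tendsto_lowerbound) auto
    with descent show False
      by simp
  qed
  then obtain ys where ys: "ys \<in> Y" "ys v* L = c"
    by blast
  then have "saddle_point \<alpha> B b L d xs ys"
    unfolding saddle_point_def ys(2) by (simp add: Y_eq c_def flip: r_def)
  then show ?thesis
    by (rule that)
qed

text \<open>
  Since \<open>y \<bullet> w \<le> \<alpha> |w|\<^sub>1\<close> for \<open>y\<close> in the box, with equality at the residual of the saddle point,
  the Lagrangian with fixed \<open>ys\<close> is a convex quadratic minorant that touches the scaled objective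
  at its own stationary point \<open>xs\<close>.
\<close>

lemma saddle_point_minimises:
  assumes B: "symmetric_matrix B" "pos_semidef B" and \<alpha>: "\<alpha> > 0"
    and saddle: "saddle_point \<alpha> B b L d xs ys"
  shows "penalised_quadratic B b L d xs \<le> penalised_quadratic B b L d z"
proof -
  define e where "e = z - xs"
  have grad: "(2 * \<alpha>) *\<^sub>R (B *v xs) + \<alpha> *\<^sub>R b + ys v* L = 0"
    and box: "\<And>i. \<bar>ys $ i\<bar> \<le> \<alpha>"
    and comp: "\<And>i. ys $ i * (L *v xs - d) $ i = \<alpha> * \<bar>(L *v xs - d) $ i\<bar>"
    using saddle by (auto simp: saddle_point_def abs_le_iff minus_le_iff)
  have "ys \<bullet> w \<le> \<alpha> * l1_norm w" for w
  proof -
    have "ys $ i * w $ i \<le> \<alpha> * \<bar>w $ i\<bar>" for i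
      using mult_right_mono[OF box[of i], of "\<bar>w $ i\<bar>"] abs_ge_self[of "ys $ i * w $ i"]
      by (simp add: abs_mult)
    then show ?thesis
      by (simp add: l1_norm_def inner_vec_def sum_distrib_left sum_mono)
  qed
  then have 1: "ys \<bullet> (L *v z - d) \<le> \<alpha> * l1_norm (L *v z - d)" .
  have 2: "ys \<bullet> (L *v xs - d) = \<alpha> * l1_norm (L *v xs - d)"
    using comp by (simp add: l1_norm_def inner_vec_def sum_distrib_left)
  have 3: "ys \<bullet> (L *v z - d) = ys \<bullet> (L *v xs - d) + (ys v* L) \<bullet> e"
    by (simp add: e_def dot_lmul_matrix inner_simps matrix_vector_mult_diff_distrib)
  have 4: "((2 * \<alpha>) *\<^sub>R (B *v xs) + \<alpha> *\<^sub>R b + ys v* L) \<bullet> e = 0"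
    by (simp add: grad)
  have 5: "0 \<le> \<alpha> * (e \<bullet> (B *v e))"
    using B(2) \<alpha> by (simp add: pos_semidef_def)
  have 6: "z \<bullet> (B *v z) = xs \<bullet> (B *v xs) + 2 * ((B *v xs) \<bullet> e) + e \<bullet> (B *v e)"
    using quadratic_form_add[OF B(1), of xs e] by (simp add: e_def)
  have 7: "b \<bullet> z = b \<bullet> xs + b \<bullet> e"
    by (simp add: e_def inner_simps)
  have "\<alpha> * penalised_quadratic B b L d xs \<le> \<alpha> * penalised_quadratic B b L d z"
    unfolding penalised_quadratic_def 6 7 using 1 2 3 4 5
    by (simp add: inner_add_left distrib_left algebra_simps)
  then show ?thesis
    using \<alpha> by simp
qed

section \<open>The primal-dual iteration\<close>

lemma clip_variational_inequality:
  fixes c s \<alpha> :: real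
  assumes q: "q > 0" and s: "s \<in> {-\<alpha>..\<alpha>}"
  defines "y \<equiv> closest_point {-\<alpha>..\<alpha>} (c / q)"
  shows "y \<in> {-\<alpha>..\<alpha>}" "(c - q * y) * (s - y) \<le> 0"
proof -
  show "y \<in> {-\<alpha>..\<alpha>}"
    unfolding y_def by (rule closest_point_in_set) (use s in auto)
  have "(c / q - y) * (s - y) \<le> 0"
    using closest_point_dot[of "{-\<alpha>..\<alpha>}" s "c / q"] s by (simp add: y_def)
  moreover have "c - q * y = q * (c / q - y)"
    using q by (simp add: right_diff_distrib)
  ultimately show "(c - q * y) * (s - y) \<le> 0"
    using q by (simp only: mult.assoc) (simp add: mult_le_0_iff)
qed

lemma diag_matrix_vector_nth: "(diag_matrix q *v v) $ i = q $ i * v $ i"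
  by (simp add: diag_matrix_def matrix_vector_mult_def if_distrib[where f = "\<lambda>c. c * _"] cong: if_cong)

lemma pos_def_diag_matrix:
  assumes "\<And>i. q $ i > 0"
  shows "pos_def (diag_matrix q)"
  unfolding pos_def_def
proof (intro allI impI)
  fix v :: "real^'a" assume "v \<noteq> 0"
  then obtain i where "v $ i \<noteq> 0"
    by (auto simp: vec_eq_iff)
  then have "0 < q $ i * (v $ i)\<^sup>2"
    using assms by simp
  then have "0 < (\<Sum>i\<in>UNIV. q $ i * (v $ i)\<^sup>2)"
    by (intro sum_pos2[of _ i]) (auto simp: assms less_imp_le)
  then show "0 < v \<bullet> (diag_matrix q *v v)"
    by (simp add: inner_vec_def diag_matrix_vector_nth power2_eq_square algebra_simps)
qed

text \<open>
  With \<open>M (u, v) = (P u + L\<^sup>T v, L u + Q v)\<close>, both update formulas depend on the previous iterate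
  only through its image under \<open>M\<close>, so the iteration is a degenerate proximal point iteration for the
  monotone operator of the saddle-point problem. The extrapolation \<open>y\<^sub>n - 2 y\<^sub>n\<^sub>+\<^sub>1\<close> is what makes
  \<open>M\<close> symmetric.
\<close>

lemma primal_dual_iteration_converges:
  fixes B P :: "real^'n^'n" and L :: "real^'n^'m" and q d :: "real^'m"
  assumes B: "symmetric_matrix B" "pos_semidef B"
    and P: "symmetric_matrix P" "pos_def P"
    and q: "\<And>i. q $ i > 0" and \<alpha>: "\<alpha> > 0"
    and bilinear: "\<And>u v. - 2 * (v \<bullet> (L *v u)) \<le> u \<bullet> (P *v u) + v \<bullet> (diag_matrix q *v v)"
    and saddle: "saddle_point \<alpha> B b L d x0 y0"
    and y_step: "\<And>n i. y (Suc n) $ i =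
                 closest_point {-\<alpha>..\<alpha>} (y n $ i + ((L *v x n) $ i - d $ i) / q $ i)"
    and x_step: "\<And>n. x (Suc n) =
               matrix_inv (P + (2 * \<alpha>) *\<^sub>R B) *v
                 (transpose L *v (y n - 2 *\<^sub>R y (Suc n)) + P *v x n - \<alpha> *\<^sub>R b)"
  obtains xs ys where "saddle_point \<alpha> B b L d xs ys" "x \<longlonglongrightarrow> xs"
proof -
  let ?Q = "diag_matrix q" and ?R = "P + (2 * \<alpha>) *\<^sub>R B"
  have Q_sym: "(?Q *v u) \<bullet> v = u \<bullet> (?Q *v v)" for u v
    by (simp add: inner_vec_def diag_matrix_vector_nth algebra_simps)
  have R_mv: "?R *v u = P *v u + (2 * \<alpha>) *\<^sub>R (B *v u)" for u
    by (simp add: matrix_vector_mult_add_rdistrib scaleR_matrix_vector_assoc)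
  have "pos_def ?R"
    using P(2) B(2) \<alpha> by (auto simp: pos_def_def pos_semidef_def R_mv inner_simps intro!: add_pos_nonneg)
  then have R_inv: "?R *v (matrix_inv ?R *v u) = u" for u
    using pos_def_invertible[of ?R] by (simp add: matrix_vector_mul_assoc)
  define M where "M = (\<lambda>(u, v). (P *v u + v v* L, L *v u + ?Q *v v))"
  define clip where "clip c = (\<chi> i. closest_point {-\<alpha>..\<alpha>} ((c $ i - d $ i) / q $ i))" for c
  define F where "F = (\<lambda>(a, c).
    (matrix_inv ?R *v (a - 2 *\<^sub>R (clip c v* L) - \<alpha> *\<^sub>R b), clip c))"
  have psdM: "psd_operator M"
    unfolding psd_operator_def
  proof (intro conjI allI)
    show "linear M"
      by (rule linearI) (auto simp: M_def matrix_vector_right_distrib matrix_vector_mult_scaleR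
          vector_matrix_left_distrib scaleR_vector_matrix_assoc algebra_simps
          simp flip: transpose_matrix_vector)
    show "M w \<bullet> z = w \<bullet> M z" for w z
      by (cases w, cases z) (simp add: M_def inner_add_left inner_add_right dot_lmul_matrix
          symmetric_inner[OF P(1)] Q_sym inner_commute[of _ "_ v* L"] inner_commute[of "L *v _"]
          del: vector_transpose_matrix)
    show "0 \<le> w \<bullet> M w" for w
      using bilinear[of "snd w" "fst w"]
      by (cases w) (simp add: M_def inner_add_right inner_commute[of _ "_ v* L"] dot_lmul_matrix)
  qed
  have contF: "continuous_on UNIV F"
  proof -
    have "continuous_on UNIV clip"
      unfolding clip_def
      by (intro continuous_on_vec_lambda continuous_on_compose2[OF continuous_on_closest_point]
          continuous_intros) (use \<alpha> q in \<open>auto simp: less_imp_neq[symmetric]\<close>)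
    then have clip_snd: "continuous_on UNIV (\<lambda>p :: (real^'n) \<times> (real^'m). clip (snd p))"
      by (rule continuous_on_compose2) (auto intro: continuous_intros)
    show ?thesis
      unfolding F_def case_prod_beta transpose_matrix_vector[symmetric]
      by (intro continuous_intros clip_snd
          bounded_linear.continuous_on[OF matrix_vector_mul_bounded_linear])
  qed
  define Z where "Z = {(u, v). saddle_point \<alpha> B b L d u v}"
  \<comment> \<open>the displacement lies in the operator: its first component is the \<open>x\<close>-gradient at the new
      iterate, and its second is governed by the variational inequality of the projection\<close>
  have optimality: "M (u, v) - M (F (M (u, v)))
      = ((2 * \<alpha>) *\<^sub>R (B *v u') + \<alpha> *\<^sub>R b + v' v* L, L *v u + ?Q *v v - ?Q *v v' - L *v u')"
    if "F (M (u, v)) = (u', v')" for u v u' v'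
  proof -
    have v': "v' = clip (L *v u + ?Q *v v)"
      using that by (simp add: M_def F_def)
    then have "u' = matrix_inv ?R *v (P *v u + v v* L - 2 *\<^sub>R (v' v* L) - \<alpha> *\<^sub>R b)"
      using that by (simp add: M_def F_def)
    then have "P *v u' + (2 * \<alpha>) *\<^sub>R (B *v u') = P *v u + v v* L - 2 *\<^sub>R (v' v* L) - \<alpha> *\<^sub>R b"
      by (metis R_inv R_mv)
    then show ?thesis
      unfolding that by (simp add: M_def algebra_simps scaleR_2)
  qed
  have fixed_saddle: "z \<in> Z" if "F (M z) = z" for z
  proof -
    obtain u v where z: "z = (u, v)"
      by (cases z)
    have opt: "(2 * \<alpha>) *\<^sub>R (B *v u) + \<alpha> *\<^sub>R b + v v* L = 0"
      using optimality[of u v u v] that by (simp add: z zero_prod_def)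
    have v: "v = clip (L *v u + ?Q *v v)"
      using that by (simp add: z M_def F_def)
    have "v $ i \<in> {-\<alpha>..\<alpha>} \<and> v $ i * (L *v u - d) $ i = \<alpha> * \<bar>(L *v u - d) $ i\<bar>" for i
    proof -
      define c where "c = (L *v u + ?Q *v v) $ i - d $ i"
      define r where "r = (L *v u - d) $ i"
      have vi: "v $ i = closest_point {-\<alpha>..\<alpha>} (c / q $ i)"
        by (subst v) (simp add: clip_def c_def)
      have r: "c - q $ i * v $ i = r"
        by (simp add: c_def r_def diag_matrix_vector_nth)
      have box: "v $ i \<in> {-\<alpha>..\<alpha>}"
        using clip_variational_inequality(1)[OF q[of i], of 0 \<alpha> c] \<alpha> by (simp add: vi)
      have "r * (s - v $ i) \<le> 0" if "s \<in> {-\<alpha>..\<alpha>}" for s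
        using clip_variational_inequality(2)[OF q[of i] that, of c] by (simp add: r flip: vi)
      from this[of \<alpha>] this[of "- \<alpha>"] have "\<alpha> * \<bar>r\<bar> \<le> v $ i * r"
        using \<alpha> by (simp add: abs_if algebra_simps)
      moreover have "v $ i * r \<le> \<alpha> * \<bar>r\<bar>"
      proof -
        have "v $ i * r \<le> \<bar>v $ i\<bar> * \<bar>r\<bar>"
          by (metis abs_ge_self abs_mult)
        also have "\<dots> \<le> \<alpha> * \<bar>r\<bar>"
          using box by (intro mult_right_mono) auto
        finally show ?thesis .
      qed
      ultimately show ?thesis
        using box by (simp add: r_def)
    qed
    with opt show ?thesis
      by (simp add: z Z_def saddle_point_def)
  qed
  have monotone: "0 \<le> M (w - F (M w)) \<bullet> (F (M w) - z)" if "z \<in> Z" for z w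
  proof -
    obtain u v u' v' us vs where w: "w = (u, v)" and F_w: "F (M w) = (u', v')" and z: "z = (us, vs)"
      by (metis surj_pair)
    have grad: "(2 * \<alpha>) *\<^sub>R (B *v us) + \<alpha> *\<^sub>R b + vs v* L = 0"
      and box: "\<And>i. vs $ i \<in> {-\<alpha>..\<alpha>}"
      and comp: "\<And>i. vs $ i * (L *v us - d) $ i = \<alpha> * \<bar>(L *v us - d) $ i\<bar>"
      using that by (auto simp: z Z_def saddle_point_def)
    define g where "g = L *v u + ?Q *v v - ?Q *v v' - L *v u'"
    have v': "v' = clip (L *v u + ?Q *v v)"
      using F_w by (simp add: w M_def F_def)
    \<comment> \<open>adding \<open>L u' - d\<close> to \<open>g\<close> gives the residual \<open>c - q v'\<close> of the projection in each coordinate\<close>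
    have "0 \<le> (g - (d - L *v us) + L *v (u' - us)) \<bullet> (v' - vs)"
      unfolding inner_vec_def
    proof (intro sum_nonneg)
      fix i
      define c where "c = (L *v u + ?Q *v v) $ i - d $ i"
      define r where "r = (L *v us - d) $ i"
      have vi: "v' $ i = closest_point {-\<alpha>..\<alpha>} (c / q $ i)"
        by (subst v') (simp add: clip_def c_def)
      have vi_le: "(c - q $ i * v' $ i) * (vs $ i - v' $ i) \<le> 0"
        using clip_variational_inequality(2)[OF q[of i] box[of i], of c] by (simp flip: vi)
      have g_eq: "(g - (d - L *v us) + L *v (u' - us)) $ i = c - q $ i * v' $ i"
        by (simp add: g_def c_def diag_matrix_vector_nth matrix_vector_mult_diff_distrib)
      show "0 \<le> (g - (d - L *v us) + L *v (u' - us)) $ i \<bullet> (v' - vs) $ i"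
        unfolding g_eq using vi_le by (simp add: algebra_simps)
    qed
    moreover have "(L *v us - d) \<bullet> (v' - vs) \<le> 0"
      unfolding inner_vec_def
    proof (intro sum_nonpos)
      fix i
      have "v' $ i \<in> {-\<alpha>..\<alpha>}"
        using clip_variational_inequality(1)[OF q[of i] box[of i]] by (simp add: v' clip_def)
      then have "\<bar>v' $ i\<bar> * \<bar>(L *v us - d) $ i\<bar> \<le> \<alpha> * \<bar>(L *v us - d) $ i\<bar>"
        by (intro mult_right_mono) auto
      then have "v' $ i * (L *v us - d) $ i \<le> vs $ i * (L *v us - d) $ i"
        unfolding comp by (metis abs_ge_self abs_mult order_trans)
      then show "(L *v us - d) $ i \<bullet> (v' - vs) $ i \<le> 0"
        by (simp add: algebra_simps)
    qed
    moreover have "0 \<le> \<alpha> * ((B *v (u' - us)) \<bullet> (u' - us))"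
      using B(2) \<alpha> by (simp add: pos_semidef_def inner_commute)
    moreover have "((2 * \<alpha>) *\<^sub>R (B *v u') + \<alpha> *\<^sub>R b + v' v* L) \<bullet> (u' - us)
        = 2 * (\<alpha> * ((B *v (u' - us)) \<bullet> (u' - us))) + (L *v (u' - us)) \<bullet> (v' - vs)"
    proof -
      have "((2 * \<alpha>) *\<^sub>R (B *v u') + \<alpha> *\<^sub>R b + v' v* L)
          = ((2 * \<alpha>) *\<^sub>R (B *v u') + \<alpha> *\<^sub>R b + v' v* L)
            - ((2 * \<alpha>) *\<^sub>R (B *v us) + \<alpha> *\<^sub>R b + vs v* L)"
        by (simp add: grad)
      also have "\<dots> = (2 * \<alpha>) *\<^sub>R (B *v (u' - us)) + (v' v* L - vs v* L)"
        by (simp add: matrix_vector_mult_diff_distrib algebra_simps)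
      finally show ?thesis
        unfolding inner_commute[of "L *v (u' - us)" "v' - vs"]
        by (simp only: inner_add_left inner_diff_left dot_lmul_matrix inner_scaleR_left)
    qed
    moreover have "M (w - F (M w)) \<bullet> (F (M w) - z)
        = ((2 * \<alpha>) *\<^sub>R (B *v u') + \<alpha> *\<^sub>R b + v' v* L) \<bullet> (u' - us) + g \<bullet> (v' - vs)"
    proof -
      have "M (w - F (M w)) = M w - M (F (M w))"
        using psdM by (simp add: psd_operator_def linear_diff)
      also have "\<dots> = ((2 * \<alpha>) *\<^sub>R (B *v u') + \<alpha> *\<^sub>R b + v' v* L, g)"
        using optimality F_w by (simp add: w g_def)
      finally show ?thesis
        by (simp add: F_w z)
    qed
    ultimately show ?thesis
      by (simp add: inner_add_left inner_diff_left)
  qed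
  have step: "(x (Suc n), y (Suc n)) = F (M (x n, y n))" for n
  proof -
    have y: "y (Suc n) = clip (L *v x n + ?Q *v y n)"
      using q by (simp add: vec_eq_iff clip_def y_step diag_matrix_vector_nth field_simps less_imp_neq[symmetric])
    show ?thesis
      unfolding x_step M_def F_def prod.case y[symmetric]
      by (simp add: algebra_simps scaleR_vector_matrix_assoc)
  qed
  obtain z where "F (M z) = z" "(\<lambda>n. (x n, y n)) \<longlonglongrightarrow> z"
    by (rule degenerate_proximal_point_converges[OF psdM contF, of "\<lambda>n. (x n, y n)" "(x0, y0)" Z])
      (use step fixed_saddle monotone saddle in \<open>auto simp: Z_def\<close>)
  then have "z \<in> Z" "x \<longlonglongrightarrow> fst z"
    using fixed_saddle tendsto_fst by fastforce+
  then show ?thesis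
    using that[of "fst z" "snd z"] by (simp add: Z_def case_prod_beta)
qed

theorem theorem4p4:
  fixes \<Omega> :: "(real^'d) set" and \<T> :: "(real^'d) set set" and k :: nat
    and W :: "('d, real) broken set" and V :: "('d, real^'d) broken set"
    and \<phi>w :: "'n::finite \<Rightarrow> ('d, real) broken" and \<phi>v :: "'n \<Rightarrow> ('d, real^'d) broken"
    and A :: "real^'d \<Rightarrow> real^'d^'d" and f g :: "real^'d \<Rightarrow> real"
    and Tp Tm :: "(real^'d) set \<Rightarrow> (real^'d) set"
    and row :: "'m::finite \<Rightarrow> (real^'d) penalty_row"
    and B P :: "real^'n^'n" and b :: "real^'n"
    and L :: "real^'n^'m" and d q :: "real^'m"
    and \<tau> \<alpha> :: real
    and x0 :: "real^'n" and y0 :: "real^'m"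
    and x :: "nat \<Rightarrow> real^'n" and y :: "nat \<Rightarrow> real^'m"
  assumes "triangulates \<T> \<Omega>"
    and "k \<ge> 1"
    and "broken_subspace W" and "\<And>w. w \<in> W \<Longrightarrow> piecewise_polynomial \<T> k w"
    and "broken_subspace V" and "\<And>v. v \<in> V \<Longrightarrow> piecewise_polynomial_vec \<T> (k - 1) v"
    and "product_basis \<phi>w \<phi>v W V"
    and "in_Linfty \<Omega> A" and "in_L2 \<Omega> f"
    and "symmetric_matrix B" and "pos_semidef B"
    and "\<And>z. z \<bullet> (B *v z) + b \<bullet> z =
               least_squares \<Omega> \<T> A f (lincomb \<phi>w z) (lincomb \<phi>v z) - (L2_norm \<Omega> f)\<^sup>2"
    and "\<tau> > 0"
    and "orientation \<T> Tp Tm"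
    and "bij_betw row UNIV (penalty_rows \<T>)"
    and "\<And>z i. (L *v z) $ i =
                 penalty_value \<T> Tp Tm \<tau> (lincomb \<phi>w z) (lincomb \<phi>v z) (row i)"
    and "\<And>i. d $ i = penalty_target \<T> \<tau> g (row i)"
    and "\<alpha> > 0"
    and "symmetric_matrix P" and "pos_def P"
    and "\<And>i. q $ i > 0"
    and "spectral_norm (matrix_inv_sqrt (diag_matrix q) ** L ** matrix_inv_sqrt P) \<le> 1"
    and "x 0 = x0" and "y 0 = y0"
    and "\<And>n i. y (Suc n) $ i =
                 closest_point {-\<alpha>..\<alpha>} (y n $ i + ((L *v x n) $ i - d $ i) / q $ i)"
    and "\<And>n. x (Suc n) =
               matrix_inv (P + (2 * \<alpha>) *\<^sub>R B) *v
                 (transpose L *v (y n - 2 *\<^sub>R y (Suc n)) + P *v x n - \<alpha> *\<^sub>R b)"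
  shows "\<exists>xs. x \<longlonglongrightarrow> xs \<and>
           is_arg_min (\<lambda>z. z \<bullet> (B *v z) + b \<bullet> z + l1_norm (L *v z - d)) (\<lambda>z. True) xs"
proof -
  note B = \<open>symmetric_matrix B\<close> \<open>pos_semidef B\<close>
  note P = \<open>symmetric_matrix P\<close> \<open>pos_def P\<close>
  note q = \<open>\<And>i. q $ i > 0\<close>
  have "- (L2_norm \<Omega> f)\<^sup>2 \<le> z \<bullet> (B *v z) + b \<bullet> z" for z
    unfolding \<open>\<And>z. z \<bullet> (B *v z) + b \<bullet> z = _ z\<close> by (simp add: least_squares_def)
  then obtain xm where "\<And>z. penalised_quadratic B b L d xm \<le> penalised_quadratic B b L d z"
    using penalised_quadratic_attains_min[OF B] by blast
  then obtain ym where saddle: "saddle_point \<alpha> B b L d xm ym"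
    using minimiser_has_multiplier[OF B(1) \<open>\<alpha> > 0\<close>] by blast
  have "symmetric_matrix (diag_matrix q)"
    by (simp add: symmetric_matrix_def diag_matrix_def transpose_def vec_eq_iff)
  moreover have "pos_def (diag_matrix q)"
    by (rule pos_def_diag_matrix) (rule q)
  ultimately have bilinear: "- 2 * (v \<bullet> (L *v u)) \<le> u \<bullet> (P *v u) + v \<bullet> (diag_matrix q *v v)" for u v
    using bilinear_bound_of_spectral_norm[OF P] assms by blast
  obtain xs ys where xs: "saddle_point \<alpha> B b L d xs ys" "x \<longlonglongrightarrow> xs"
    by (rule primal_dual_iteration_converges[where x = x and y = y, OF B P q \<open>\<alpha> > 0\<close> bilinear saddle assms(25,26)])
  have "is_arg_min (penalised_quadratic B b L d) (\<lambda>z. True) xs"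
    using saddle_point_minimises[OF B \<open>\<alpha> > 0\<close> xs(1)] by (simp add: is_arg_min_linorder)
  with xs(2) show ?thesis
    by (auto simp: penalised_quadratic_def[abs_def])
qed

end
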